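(* Let $b$ be a nonzero integer such that $p^2+bq^2$ is irreducible over $\mathbb{Q}$ (i.e. $-b$ is not a square in $\mathbb{Q}$). Let $p_0,q_0,r_0\in\mathbb{Q}$ with $r_0\neq0$, put $m=p_0^2+bq_0^2$, and let $a_2=\frac{2(m^2-r_0^4)}{r_0^2}$, $a_0=-(m^2-r_0^4)$, where it is assumed that $a_0(a_2^2-4a_0)\neq 0$. Suppose that the set of rational points $(u,w)\in\mathbb{Q}^2$ on the curve $$\mathcal{C}_1:\; w^2=-2b\Big( \big(m^4-p_0^2(m+bq_0^2)r_0^4\big)-4b^2p_0q_0^3r_0^4\,u+2b\big(m^4-(m^2-3bp_0^2q_0^2)r_0^4\big)u^2-4b^2p_0^3q_0r_0^4\,u^3+b^2\big(m^4-bq_0^2(m+p_0^2)r_0^4\big)u^4\Big)$$ is infinite. Then the set of rational points on the surface $$V_1:\;(p^2+bq^2)^2=X^4+\left(\frac{2(m^2-r_0^4)}{r_0^2}\right)X^2-(m^2-r_0^4)$$ is infinite too, in the sense that the set of $X$-coordinates of points $(p,q,X)\in V_1(\mathbb{Q})$ is infinite.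
   Context: $V_1(\mathbb{Q})$ is the set of rational solutions $(p,q,X)\in\mathbb{Q}^3$ of the displayed equation. Convention: "the set of rational points on the surface is infinite" means that its image under the projection $(p,q,X)\mapsto X$ is infinite. *)

theory Defs
  imports "HOL-Computational_Algebra.Polynomial"
begin

text \<open>The binary form $p^2 + b q^2$ as an element of $\mathbb{Q}[p][q]$: the outer indeterminate
  is $q$, and \<^term>\<open>[:0, 0, 1:] :: rat poly\<close> is $p^2$.\<close>

definition norm_form :: "rat \<Rightarrow> rat poly poly" where
  "norm_form b = [: [:0, 0, 1:], 0, [:b:] :]"

lemma irreducible_norm_form_iff:
  assumes "b \<noteq> 0"
  shows "irreducible (norm_form b) \<longleftrightarrow> (\<nexists>c. - b = c\<^sup>2)"
proof
  assume irr: "irreducible (norm_form b)"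
  show "\<nexists>c. - b = c\<^sup>2"
  proof
    assume "\<exists>c. - b = c\<^sup>2"
    then obtain c where c: "- b = c\<^sup>2" by blast
    with assms have c0: "c \<noteq> 0" by auto
    have "norm_form b = [: [:0, 1:], [:c:] :] * [: [:0, 1:], [:-c:] :]"
      using c by (simp add: norm_form_def power2_eq_square algebra_simps)
    with irr have "is_unit [: [:0, 1:], [:c:] :] \<or> is_unit [: [:0, 1:], [:-c:] :]"
      using irreducibleD by blast
    then show False
      using c0 by (auto simp: is_unit_poly_iff)
  qed
next
  assume nosq: "\<nexists>c. - b = c\<^sup>2"
  have deg: "degree (norm_form b) = 2" and lead: "lead_coeff (norm_form b) = [:b:]"
    using assms by (simp_all add: norm_form_def)
  have const: "is_unit g" if fac: "norm_form b = g * h" and d0: "degree g = 0" for g h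
  proof -
    obtain a where a: "g = [:a:]" using d0 degree_eq_zeroE by blast
    have "[:b:] = coeff (norm_form b) 2" using lead deg by simp
    also have "\<dots> = a * coeff h 2" using fac a by simp
    finally have "[:b:] = a * coeff h 2" .
    then have "a dvd [:b:]" by (rule dvdI)
    moreover have "is_unit [:b:]" using assms by (simp add: is_unit_const_poly_iff dvd_field_iff)
    ultimately have "is_unit a" using dvd_trans by blast
    then show ?thesis using a by (simp add: is_unit_const_poly_iff)
  qed
  show "irreducible (norm_form b)"
  proof (rule irreducibleI)
    show "norm_form b \<noteq> 0" using deg by auto
    show "\<not> is_unit (norm_form b)"
      using deg by (auto simp: is_unit_poly_iff)
    fix g h assume gh: "norm_form b = g * h"
    show "is_unit g \<or> is_unit h"
    proof (rule ccontr)
      assume "\<not> ?thesis"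
      then have "degree g \<noteq> 0" "degree h \<noteq> 0"
        using const[OF gh] const[of h g] gh by (auto simp: mult.commute)
      moreover have "degree g + degree h = 2"
        using deg gh degree_mult_eq[of g h] by (metis degree_0 mult_zero_left mult_zero_right zero_neq_numeral)
      ultimately have d1: "degree g = 1" "degree h = 1" by auto
      then obtain g0 g1 h0 h1 where g: "g = [:g0, g1:]" and h: "h = [:h0, h1:]"
        by (meson degree1_coeffs)
      have e: "g0 * h0 = [:0, 0, 1:]" "g0 * h1 + g1 * h0 = 0" "g1 * h1 = [:b:]"
        using gh by (simp_all add: norm_form_def g h algebra_simps)
      have nz: "g0 \<noteq> 0" "h0 \<noteq> 0" "g1 \<noteq> 0" "h1 \<noteq> 0" using e(1,3) assms by auto
      have "degree g1 + degree h1 = 0" using e(3) nz degree_mult_eq[of g1 h1] by simp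
      then obtain x y where x: "g1 = [:x:]" and y: "h1 = [:y:]"
        by (metis add_is_0 degree_eq_zeroE)
      have xy: "x * y = b" "x \<noteq> 0" "y \<noteq> 0" using e(3) x y assms by auto
      have deg0: "degree g0 + degree h0 = 2" using e(1) nz degree_mult_eq[of g0 h0] by simp
      have eq: "smult y g0 = - smult x h0" using e(2) x y
        by (simp add: eq_neg_iff_add_eq_0)
      then have "degree g0 = degree h0" using xy by (metis degree_minus degree_smult_eq)
      with deg0 have dd: "degree g0 = 1" "degree h0 = 1" by auto
      have l: "coeff g0 1 * coeff h0 1 = 1"
        using dd lead_coeff_mult[of g0 h0] e(1) by simp
      have l2: "y * coeff g0 1 = - (x * coeff h0 1)"
        using arg_cong[OF eq, of "\<lambda>p. coeff p 1"] by simp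
      have "(y * coeff g0 1)\<^sup>2 = - (x * coeff h0 1) * (y * coeff g0 1)"
        using l2 by (simp add: power2_eq_square)
      also have "\<dots> = - (x * y) * (coeff g0 1 * coeff h0 1)" by (simp add: algebra_simps)
      finally have "- b = (y * coeff g0 1)\<^sup>2" using l xy(1) by simp
      with nosq show False by blast
    qed
  qed
qed

definition curve_C1 :: "rat \<Rightarrow> rat \<Rightarrow> rat \<Rightarrow> rat \<Rightarrow> (rat \<times> rat) set" where
  "curve_C1 b p0 q0 r0 = {(u, w). let m = p0^2 + b * q0^2 in
     w^2 = - 2 * b *
       ((m^4 - p0^2 * (m + b * q0^2) * r0^4)
        - 4 * b^2 * p0 * q0^3 * r0^4 * u
        + 2 * b * (m^4 - (m^2 - 3 * b * p0^2 * q0^2) * r0^4) * u^2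
        - 4 * b^2 * p0^3 * q0 * r0^4 * u^3
        + b^2 * (m^4 - b * q0^2 * (m + p0^2) * r0^4) * u^4)}"

definition surface_V1 :: "rat \<Rightarrow> rat \<Rightarrow> rat \<Rightarrow> (rat \<times> rat \<times> rat) set" where
  "surface_V1 b a2 a0 = {(p, q, X). (p^2 + b * q^2)^2 = X^4 + a2 * X^2 + a0}"

end

theory Submission
  imports Defs
begin

text \<open>
  Write \<open>D = m\<^sup>2 - r0\<^sup>4\<close>. The coefficients \<open>a2\<close> and \<open>a0\<close> are such that the surface has the equation
  \[ r_0^4 (p^2 + b q^2)^2 = m^2 X^4 - D (X^2 - r_0^2)^2, \]
  so that it contains \<open>P0 = (p0, q0, r0)\<close>, and its tangent plane there is
  \<open>r0 (p0 p + b q0 q) = m X\<close>. This plane passes through the origin and the surface is symmetric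
  about the origin, so the plane is tangent at \<open>-P0\<close> as well. The plane section is therefore a
  quartic with two nodes, in general a curve of genus one. A line through the node \<open>P0\<close> meets it in
  two further points, and the discriminant of the quadratic equation for these, as a function of the
  slope \<open>u\<close> of the line, is up to a square the right-hand side of the equation of \<open>C\<^sub>1\<close>
  (lemma \<open>line_through_node_meets_tangent_section\<close>). Thus \<open>C\<^sub>1\<close> is a model of the tangent section,
  and infinitely many rational points on it give infinitely many on the section.

  Only finitely many points of the section have the same \<open>X\<close>: then \<open>p0 p + b q0 q\<close> is prescribed,
  and with \<open>p\<^sup>2 + b q\<^sup>2\<close> prescribed up to sign there are finitely many possibilities for \<open>(p, q)\<close>
  (lemma \<open>finite_norm_on_line\<close>). Hence infinitely many \<open>X\<close> occur.

  Two linear forms in \<open>u\<close> organise the computation, \<open>M = p0 + b q0 u\<close> and \<open>L = q0 - p0 u\<close>. The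
  multiplicativity of the norm form gives \<open>m (1 + b u\<^sup>2) = M\<^sup>2 + b L\<^sup>2\<close>.
\<close>

definition tangent_section :: "rat \<Rightarrow> rat \<Rightarrow> rat \<Rightarrow> rat \<Rightarrow> rat \<Rightarrow> rat \<Rightarrow> (rat \<times> rat \<times> rat) set" where
  "tangent_section b p0 q0 r0 a2 a0 =
     {(p, q, X) \<in> surface_V1 b a2 a0. r0 * (p0 * p + b * q0 * q) = (p0^2 + b * q0^2) * X}"

text \<open>The quartic of \<open>C\<^sub>1\<close> collapses to a combination of a square and a fourth power because
  \<open>p0\<^sup>2 (m + b q0\<^sup>2) = m\<^sup>2 - b\<^sup>2 q0\<^sup>4\<close> and \<open>b q0\<^sup>2 (m + p0\<^sup>2) = m\<^sup>2 - p0\<^sup>4\<close>.\<close>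

lemma mem_curve_C1_iff:
  fixes b p0 q0 r0 u w :: rat
  defines "m \<equiv> p0^2 + b * q0^2"
  shows "(u, w) \<in> curve_C1 b p0 q0 r0 \<longleftrightarrow>
    w^2 = - 2 * b * ((m^2 - r0^4) * m^2 * (1 + b * u^2)^2 + r0^4 * b^2 * (q0 - p0 * u)^4)"
proof -
  have const: "p0^2 * (m + b * q0^2) = m^2 - b^2 * q0^4"
    and lead: "b * q0^2 * (m + p0^2) = m^2 - p0^4"
    unfolding m_def by algebra+
  define R where "R = r0^4"
  have "(m^4 - (m^2 - b^2 * q0^4) * R)
        - 4 * b^2 * p0 * q0^3 * R * u
        + 2 * b * (m^4 - (m^2 - 3 * b * p0^2 * q0^2) * R) * u^2
        - 4 * b^2 * p0^3 * q0 * R * u^3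
        + b^2 * (m^4 - (m^2 - p0^4) * R) * u^4
      = (m^2 - R) * m^2 * (1 + b * u^2)^2 + R * b^2 * (q0 - p0 * u)^4"
    by (simp add: power2_eq_square power3_eq_cube power4_eq_xxxx algebra_simps)
  then have "(m^4 - p0^2 * (m + b * q0^2) * r0^4)
        - 4 * b^2 * p0 * q0^3 * r0^4 * u
        + 2 * b * (m^4 - (m^2 - 3 * b * p0^2 * q0^2) * r0^4) * u^2
        - 4 * b^2 * p0^3 * q0 * r0^4 * u^3
        + b^2 * (m^4 - b * q0^2 * (m + p0^2) * r0^4) * u^4
      = (m^2 - r0^4) * m^2 * (1 + b * u^2)^2 + r0^4 * b^2 * (q0 - p0 * u)^4"
    unfolding const lead R_def .
  then show ?thesis
    by (simp add: curve_C1_def Let_def m_def)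
qed

lemma surface_V1_scaled_iff:
  fixes b p q x m r0 :: rat
  assumes "r0 \<noteq> 0"
  shows "(p, q, r0 * x) \<in> surface_V1 b (2 * (m^2 - r0^4) / r0^2) (- (m^2 - r0^4)) \<longleftrightarrow>
    (p^2 + b * q^2)^2 = m^2 * x^4 - (m^2 - r0^4) * (x^2 - 1)^2"
proof -
  have "2 * (m^2 - r0^4) / r0^2 * (r0 * x)^2 = 2 * (m^2 - r0^4) * x^2"
    using assms by (simp add: power_mult_distrib)
  moreover have "(r0 * x)^4 + 2 * (m^2 - r0^4) * x^2 + - (m^2 - r0^4)
      = m^2 * x^4 - (m^2 - r0^4) * (x^2 - 1)^2"
    by algebra
  ultimately have "(r0 * x)^4 + 2 * (m^2 - r0^4) / r0^2 * (r0 * x)^2 + - (m^2 - r0^4)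
      = m^2 * x^4 - (m^2 - r0^4) * (x^2 - 1)^2"
    by (simp only:)
  then show ?thesis by (simp add: surface_V1_def)
qed

text \<open>On the line with slope \<open>u\<close> through \<open>P0\<close> in the tangent plane, \<open>s\<^sup>2\<close> divides the equation of
  the surface, because \<open>s = 0\<close> is the node. The hypothesis \<open>quad\<close> is, up to a nonzero constant, the
  quotient, a quadratic equation in \<open>s\<close>.\<close>

lemma line_point_in_tangent_section:
  fixes b p0 q0 r0 u s :: rat
  defines "m \<equiv> p0^2 + b * q0^2" and "L \<equiv> q0 - p0 * u" and "M \<equiv> p0 + b * q0 * u"
  defines "D \<equiv> m^2 - r0^4"
  assumes r0: "r0 \<noteq> 0" and m: "m \<noteq> 0"
    and quad: "b * L^2 * m^2 * (2 * (m + s * M)^2 + b * s^2 * L^2) + D * M^2 * (2 * m + s * M)^2 = 0"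
  shows "(p0 + s, q0 + s * u, r0 * (1 + s * M / m))
    \<in> tangent_section b p0 q0 r0 (2 * (m^2 - r0^4) / r0^2) (- (m^2 - r0^4))"
proof -
  define N where "N = (p0 + s)^2 + b * (q0 + s * u)^2"
  define z where "z = m + s * M"
  define x where "x = 1 + s * M / m"
  have z: "z = m * x" using m by (simp add: z_def x_def field_simps)
  have mN: "m * N = z^2 + b * s^2 * L^2"
    unfolding N_def z_def m_def L_def M_def by algebra
  have quad': "b * L^2 * m^2 * (2 * z^2 + b * s^2 * L^2) + D * M^2 * (2 * m + s * M)^2 = 0"
    using quad by (simp add: z_def)
  have zm: "z^2 - m^2 = s * M * (2 * m + s * M)"
    unfolding z_def by algebra
  have "m^4 * (N^2 - (m^2 * x^4 - D * (x^2 - 1)^2))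
      = m^2 * ((m * N)^2 - z^4) + D * (z^2 - m^2)^2"
    unfolding z by algebra
  also have "\<dots> = s^2 * (b * L^2 * m^2 * (2 * z^2 + b * s^2 * L^2) + D * M^2 * (2 * m + s * M)^2)"
    unfolding mN zm by algebra
  finally have "N^2 = m^2 * x^4 - D * (x^2 - 1)^2"
    using m quad' by simp
  moreover have "r0 * (p0 * (p0 + s) + b * q0 * (q0 + s * u)) = m * (r0 * x)"
  proof -
    have "p0 * (p0 + s) + b * q0 * (q0 + s * u) = z"
      unfolding z_def m_def M_def by algebra
    then show ?thesis by (simp add: z)
  qed
  ultimately show ?thesis
    using surface_V1_scaled_iff[OF r0]
    by (simp add: tangent_section_def N_def D_def x_def m_def)
qed

text \<open>A point \<open>(u, w)\<close> of \<open>C\<^sub>1\<close> solves the quadratic equation for the line of slope \<open>u\<close>, since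
  a quarter of its discriminant is \<open>m\<^sup>4 L\<^sup>2 w\<^sup>2\<close>. Nonvanishing of the leading coefficient is needed
  to solve for \<open>s\<close>; nonvanishing of the constant coefficient makes the point differ from the
  node.\<close>

lemma line_through_node_meets_tangent_section:
  fixes b p0 q0 r0 u w :: rat
  defines "m \<equiv> p0^2 + b * q0^2" and "L \<equiv> q0 - p0 * u" and "M \<equiv> p0 + b * q0 * u"
  defines "D \<equiv> m^2 - r0^4"
  assumes r0: "r0 \<noteq> 0" and m: "m \<noteq> 0"
    and C1: "(u, w) \<in> curve_C1 b p0 q0 r0"
    and lead: "m^2 * b^2 * L^4 + 2 * m^2 * b * (L^2 * M^2) + D * M^4 \<noteq> 0"
    and const: "b * m^2 * L^2 + 2 * D * M^2 \<noteq> 0"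
  shows "\<exists>s X. s \<noteq> 0 \<and> (p0 + s, q0 + s * u, X)
    \<in> tangent_section b p0 q0 r0 (2 * (m^2 - r0^4) / r0^2) (- (m^2 - r0^4))"
proof -
  define A where "A = m^2 * b^2 * L^4 + 2 * m^2 * b * (L^2 * M^2) + D * M^4"
  define B where "B = 2 * m * M * (m^2 * b * L^2 + D * M^2)"
  define C where "C = 2 * m^2 * (b * m^2 * L^2 + 2 * D * M^2)"
  define s where "s = (m^2 * L * w - B) / A"
  have norm: "m * (1 + b * u^2) = M^2 + b * L^2"
    unfolding m_def M_def L_def by algebra
  have w: "w^2 = - 2 * b * (D * (M^2 + b * L^2)^2 + (m^2 - D) * b^2 * L^4)"
    using C1[unfolded mem_curve_C1_iff] unfolding norm[symmetric]
    by (simp add: D_def m_def L_def power_mult_distrib mult.assoc)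
  have disc: "(m^2 * L * w)^2 = B^2 - A * C"
  proof -
    have "(m^2 * L * w)^2 = m^4 * L^2 * w^2" by algebra
    also have "\<dots> = B^2 - A * C"
      unfolding w A_def B_def C_def by algebra
    finally show ?thesis .
  qed
  have "A * s + B = m^2 * L * w"
    using lead by (simp add: s_def A_def)
  then have "A * (A * s^2 + 2 * B * s + C) = 0"
    using disc by algebra
  then have quad: "A * s^2 + 2 * B * s + C = 0"
    using lead by (simp add: A_def)
  have "b * L^2 * m^2 * (2 * (m + s * M)^2 + b * s^2 * L^2) + D * M^2 * (2 * m + s * M)^2
      = A * s^2 + 2 * B * s + C"
    unfolding A_def B_def C_def by algebra
  then have on: "(p0 + s, q0 + s * u, r0 * (1 + s * M / m))
    \<in> tangent_section b p0 q0 r0 (2 * (m^2 - r0^4) / r0^2) (- (m^2 - r0^4))"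
    using line_point_in_tangent_section[of r0 p0 b q0 u s] r0 m quad
    by (simp add: m_def L_def M_def D_def)
  have "C \<noteq> 0" using const m by (simp add: C_def)
  then have "s \<noteq> 0" using quad by auto
  with on show ?thesis by blast
qed

text \<open>The exceptional slopes are zeros of binary forms in \<open>L\<close> and \<open>M\<close>. Since \<open>L\<close> and \<open>M\<close> are
  linearly independent, \<open>M / L\<close> is an injective function of \<open>u\<close> away from the zero of \<open>L\<close>, so
  such a form vanishes for finitely many \<open>u\<close>.\<close>

lemma finite_zeros_form_in_linear_forms:
  fixes l0 l1 m0 m1 c0 c1 c2 :: "'a::field"
  assumes indep: "l0 * m1 \<noteq> l1 * m0" and c: "c0 \<noteq> 0 \<or> c1 \<noteq> 0 \<or> c2 \<noteq> 0"
  shows "finite {u. c0 * (l0 + l1 * u)^4 + c1 * ((l0 + l1 * u)^2 * (m0 + m1 * u)^2)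
    + c2 * (m0 + m1 * u)^4 = 0}" (is "finite ?Z")
proof -
  let ?L = "\<lambda>u. l0 + l1 * u" and ?M = "\<lambda>u. m0 + m1 * u"
  let ?P = "[:c0, 0, c1, 0, c2:]"
  have inj: "u = v" if "?M u * ?L v = ?M v * ?L u" for u v
  proof -
    have "(l0 * m1 - l1 * m0) * (u - v) = ?M u * ?L v - ?M v * ?L u"
      by (simp add: algebra_simps)
    also have "\<dots> = 0" using that by simp
    finally show ?thesis using indep by simp
  qed
  have "?P \<noteq> 0" using c by auto
  then have roots: "finite {t. poly ?P t = 0}" by (rule poly_roots_finite)
  have slope_inj: "inj_on (\<lambda>u. ?M u / ?L u) {u \<in> ?Z. ?L u \<noteq> 0}"
  proof (rule inj_onI)
    fix u v assume "u \<in> {u \<in> ?Z. ?L u \<noteq> 0}" "v \<in> {u \<in> ?Z. ?L u \<noteq> 0}"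
      and eq: "?M u / ?L u = ?M v / ?L v"
    then have "?L u \<noteq> 0" "?L v \<noteq> 0" by blast+
    from eq[unfolded frac_eq_eq[OF this]] show "u = v" by (rule inj)
  qed
  have slope_root: "(\<lambda>u. ?M u / ?L u) ` {u \<in> ?Z. ?L u \<noteq> 0} \<subseteq> {t. poly ?P t = 0}"
  proof (rule image_subsetI)
    fix u assume u: "u \<in> {u \<in> ?Z. ?L u \<noteq> 0}"
    define l where "l = ?L u"
    define t where "t = ?M u / l"
    have form: "c0 * ?L u^4 + c1 * (?L u^2 * ?M u^2) + c2 * ?M u^4 = 0"
      using u by blast
    have l: "l \<noteq> 0" using u unfolding l_def by blast
    then have M: "?M u = t * l" by (simp only: t_def) simp
    have "l^4 * poly ?P t = c0 * l^4 + c1 * (l^2 * (t * l)^2) + c2 * (t * l)^4"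
      by (simp add: power2_eq_square power4_eq_xxxx algebra_simps)
    also have "\<dots> = 0"
      using form unfolding l_def[symmetric] M .
    finally show "?M u / ?L u \<in> {t. poly ?P t = 0}"
      using l unfolding t_def l_def by (simp only: mult_eq_0_iff power_eq_0_iff) blast
  qed
  have "finite {u \<in> ?Z. ?L u \<noteq> 0}"
    using slope_inj slope_root roots by (rule inj_on_finite)
  moreover have "finite {u. ?L u = 0}"
  proof (cases "{u. ?L u = 0} = {}")
    case False
    then obtain v where v: "?L v = 0" by blast
    have "u = v" if "?L u = 0" for u
      by (rule inj) (simp only: that v mult_zero_right)
    then have "{u. ?L u = 0} \<subseteq> {v}" by blast
    then show ?thesis by (rule finite_subset) simp
  qed simp
  ultimately have "finite ({u \<in> ?Z. ?L u \<noteq> 0} \<union> {u. ?L u = 0})" by (rule finite_UnI)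
  then show ?thesis by (rule rev_finite_subset) blast
qed

text \<open>The two bilinear expressions \<open>d = p0 p + b q0 q\<close> and \<open>e = p0 q - q0 p\<close> determine \<open>(p, q)\<close>, and
  \<open>(p0\<^sup>2 + b q0\<^sup>2) (p\<^sup>2 + b q\<^sup>2) = d\<^sup>2 + b e\<^sup>2\<close>. With \<open>d\<close> fixed, \<open>e\<close> is thus a root of a quartic.\<close>

lemma finite_norm_on_line:
  fixes b p0 q0 c d :: "'a::field"
  assumes b: "b \<noteq> 0" and m: "p0^2 + b * q0^2 \<noteq> 0"
  shows "finite {(p, q). (p^2 + b * q^2)^2 = c \<and> p0 * p + b * q0 * q = d}" (is "finite ?S")
proof -
  define m where "m = p0^2 + b * q0^2"
  let ?e = "\<lambda>(p, q). p0 * q - q0 * p"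
  let ?P = "[:d^4 - m^2 * c, 0, 2 * b * d^2, 0, b^2:]"
  have "?P \<noteq> 0" using b by simp
  then have "finite {e. poly ?P e = 0}" by (rule poly_roots_finite)
  moreover have "inj_on ?e ?S"
  proof (rule inj_onI, clarify)
    fix p q p' q'
    assume d: "d = p0 * p + b * q0 * q" and d': "p0 * p' + b * q0 * q' = p0 * p + b * q0 * q"
      and e: "p0 * q - q0 * p = p0 * q' - q0 * p'"
    have "m * (p - p') = 0" and "m * (q - q') = 0"
      using d' e unfolding m_def by algebra+
    with m show "p = p' \<and> q = q'" by (simp add: m_def)
  qed
  moreover have "?e ` ?S \<subseteq> {e. poly ?P e = 0}"
  proof (rule image_subsetI, clarify)
    fix p q
    have "(m * (p^2 + b * q^2))^2 = ((p0 * p + b * q0 * q)^2 + b * (p0 * q - q0 * p)^2)^2"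
      unfolding m_def by algebra
    then show "poly [:(p0 * p + b * q0 * q)^4 - m^2 * (p^2 + b * q^2)^2, 0,
        2 * b * (p0 * p + b * q0 * q)^2, 0, b^2:] (p0 * q - q0 * p) = 0"
      by (simp, algebra)
  qed
  ultimately show ?thesis using inj_on_finite by blast
qed

lemma infinite_X_of_infinite_tangent_section:
  fixes b p0 q0 r0 a2 a0 :: rat
  assumes b: "b \<noteq> 0" and r0: "r0 \<noteq> 0" and m: "p0^2 + b * q0^2 \<noteq> 0"
    and inf: "infinite (tangent_section b p0 q0 r0 a2 a0)"
  shows "infinite ((\<lambda>(p, q, X). X) ` surface_V1 b a2 a0)"
proof
  let ?X = "\<lambda>(p, q, X). X :: rat" and ?T = "tangent_section b p0 q0 r0 a2 a0"
  assume "finite (?X ` surface_V1 b a2 a0)"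
  moreover have "?T \<subseteq> surface_V1 b a2 a0"
    by (auto simp: tangent_section_def)
  ultimately have "finite (?X ` ?T)"
    by (meson finite_subset image_mono)
  moreover have "finite {P \<in> ?T. ?X P = x}" for x
  proof -
    let ?d = "(p0^2 + b * q0^2) * x / r0"
    let ?F = "{(p, q). (p^2 + b * q^2)^2 = x^4 + a2 * x^2 + a0 \<and> p0 * p + b * q0 * q = ?d}"
    have "{P \<in> ?T. ?X P = x} \<subseteq> (\<lambda>(p, q). (p, q, x)) ` ?F"
      using r0 by (auto simp: tangent_section_def surface_V1_def field_simps)
    moreover have "finite ?F" by (rule finite_norm_on_line[OF b m])
    ultimately show ?thesis using finite_surj by blast
  qed
  ultimately have "finite ?T"
    using pigeonhole_infinite[of ?T ?X] by blast
  with inf show False by simp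
qed

lemma infinite_slopes_of_infinite_curve_C1:
  assumes "infinite (curve_C1 b p0 q0 r0)"
  shows "infinite (fst ` curve_C1 b p0 q0 r0)"
proof
  assume "finite (fst ` curve_C1 b p0 q0 r0)"
  then obtain u where "infinite {P \<in> curve_C1 b p0 q0 r0. fst P = u}"
    using pigeonhole_infinite[OF assms] by auto
  moreover obtain k where k: "\<And>w. (u, w) \<in> curve_C1 b p0 q0 r0 \<Longrightarrow> w^2 = k"
    unfolding mem_curve_C1_iff by blast
  have "{P \<in> curve_C1 b p0 q0 r0. fst P = u} \<subseteq> Pair u ` {w. poly [:- k, 0, 1:] w = 0}"
    using k by (auto simp: power2_eq_square)
  moreover have "finite {w. poly [:- k, 0, 1:] w = 0}"
    by (rule poly_roots_finite) simp
  ultimately show False using finite_surj by blast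
qed

theorem theorem3p6:
  fixes b :: int and p0 q0 r0 m a2 a0 :: rat
  assumes "b \<noteq> 0"
    and "irreducible (norm_form (of_int b))"
    and "r0 \<noteq> 0"
    and "m = p0^2 + of_int b * q0^2"
    and "a2 = 2 * (m^2 - r0^4) / r0^2"
    and "a0 = - (m^2 - r0^4)"
    and "a0 * (a2^2 - 4 * a0) \<noteq> 0"
    and "infinite (curve_C1 (of_int b) p0 q0 r0)"
  shows "infinite ((\<lambda>(p, q, X). X) ` surface_V1 (of_int b) a2 a0)"
proof -
  define c :: rat where "c = of_int b"
  define D where "D = m^2 - r0^4"
  have c0: "c \<noteq> 0" using assms(1) by (simp add: c_def)
  have mc: "m = p0^2 + c * q0^2" using assms(4) by (simp add: c_def)
  have D0: "D \<noteq> 0" using assms(6,7) by (auto simp: D_def)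
  \<comment> \<open>The nondegeneracy hypothesis amounts to \<open>D\<^sup>2 m\<^sup>2 \<noteq> 0\<close>, as
    \<open>a2\<^sup>2 - 4 a0 = 4 D (D + r0\<^sup>4) / r0\<^sup>4 = 4 D m\<^sup>2 / r0\<^sup>4\<close>.\<close>
  have m0: "m \<noteq> 0"
  proof
    assume "m = 0"
    then have "a2^2 - 4 * a0 = 0"
      using assms(3,5,6) by (simp add: power2_eq_square power4_eq_xxxx field_simps)
    with assms(7) show False by simp
  qed
  let ?L = "\<lambda>u. q0 - p0 * u" and ?M = "\<lambda>u. p0 + c * q0 * u"
  define lead where
    "lead u = m^2 * c^2 * ?L u^4 + 2 * m^2 * c * (?L u^2 * ?M u^2) + D * ?M u^4" for u
  define const where "const u = c * m^2 * ?L u^2 + 2 * D * ?M u^2" for u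
  have indep: "q0 * (c * q0) \<noteq> (- p0) * p0"
    using m0 mc by (simp add: power2_eq_square eq_neg_iff_add_eq_0 algebra_simps)
  have "finite {u. lead u = 0}"
    using finite_zeros_form_in_linear_forms[OF indep, of "m^2 * c^2" "2 * m^2 * c" D] D0
    by (simp add: lead_def)
  moreover have "finite {u. const u = 0}"
  proof (rule finite_subset)
    \<comment> \<open>Multiplication by \<open>L\<^sup>2\<close> turns the quadratic form into a quartic one.\<close>
    show "{u. const u = 0} \<subseteq>
      {u. c * m^2 * ?L u^4 + 2 * D * (?L u^2 * ?M u^2) + 0 * ?M u^4 = 0}"
    proof clarify
      fix u assume "const u = 0"
      then show "c * m^2 * ?L u^4 + 2 * D * (?L u^2 * ?M u^2) + 0 * ?M u^4 = 0"
        unfolding const_def by algebra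
    qed
    show "finite {u. c * m^2 * ?L u^4 + 2 * D * (?L u^2 * ?M u^2) + 0 * ?M u^4 = 0}"
      using finite_zeros_form_in_linear_forms[OF indep, of "c * m^2" "2 * D" 0] D0 by simp
  qed
  moreover have "infinite (fst ` curve_C1 c p0 q0 r0)"
    using assms(8) by (intro infinite_slopes_of_infinite_curve_C1) (simp add: c_def)
  ultimately have inf: "infinite (fst ` curve_C1 c p0 q0 r0 - ({u. lead u = 0} \<union> {u. const u = 0}))"
    by (intro Diff_infinite_finite) auto
  let ?T = "tangent_section c p0 q0 r0 a2 a0"
  have "fst ` curve_C1 c p0 q0 r0 - ({u. lead u = 0} \<union> {u. const u = 0})
    \<subseteq> (\<lambda>(p, q, X). (q - q0) / (p - p0)) ` ?T"
  proof
    fix u assume u: "u \<in> fst ` curve_C1 c p0 q0 r0 - ({u. lead u = 0} \<union> {u. const u = 0})"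
    then obtain w where "(u, w) \<in> curve_C1 c p0 q0 r0" by auto
    then obtain s X where s: "s \<noteq> 0" "(p0 + s, q0 + s * u, X) \<in> ?T"
      using line_through_node_meets_tangent_section[of r0 p0 c q0 u w] u assms(3,5,6) m0
      by (auto simp: mc lead_def const_def D_def)
    then show "u \<in> (\<lambda>(p, q, X). (q - q0) / (p - p0)) ` ?T"
      by (intro image_eqI[OF _ s(2)]) simp
  qed
  then have "infinite ?T"
    using inf finite_surj by blast
  then show ?thesis
    using infinite_X_of_infinite_tangent_section[OF c0 assms(3)] m0
    by (simp add: mc c_def)
qed

end
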